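(* Let $b\ge 2$ be an integer and let $f=S_{1,b}$. Then for every positive integer $n$ some iterate $f^k(n)$ ($k\ge 0$) lies in one of the following cycles of $f$: if $b=2$, the fixed point $10_2=2$; if $b\ge 3$, either the cycle $(2,3,\dots,b-1,10_b)$ (where $10_b=b$, and $f(j)=j+1$ for $2\le j\le b-1$, $f(b)=2$) or the fixed point $1(b-2)_b=2b-2$.
   Context: For integers $t\ge 0$, $b\ge 2$, the $t$-shifted Sloane map in base $b$ is $S_{t,b}(n)=\prod_{i=0}^k (d_i+t)$, where $n=\sum_{i=0}^k d_ib^i$ is the base-$b$ expansion of $n$ ($0\le d_i\le b-1$, $d_k>0$). $f^0(n)=n$ and $f^k(n)=f(f^{k-1}(n))$. The notation $(x_1x_2\dots)_b$ denotes a numeral in base $b$. *)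

theory Defs
  imports "HOL-Library.Log_Nat"
begin

text \<open>
  For \<open>b \<ge> 2\<close> and \<open>n > 0\<close>, \<open>floorlog b n\<close> is the number of base-\<open>b\<close> digits of \<open>n\<close>, so the
  index \<open>i\<close> below runs over \<open>0, ..., k\<close> with \<open>k\<close> the position of the leading nonzero digit.
  Since \<open>0\<close> has no expansion with nonzero leading digit, \<open>sloane t b 0\<close> is just the empty product.
\<close>

definition sloane :: "nat \<Rightarrow> nat \<Rightarrow> nat \<Rightarrow> nat" where
  "sloane t b n = (\<Prod>i<floorlog b n. n div b ^ i mod b + t)"

text \<open>Numerals are written with the most significant digit first.\<close>

definition base_num :: "nat \<Rightarrow> nat list \<Rightarrow> nat" where
  "base_num b ds = horner_sum id b (rev ds)"

definition is_cycle :: "('a \<Rightarrow> 'a) \<Rightarrow> 'a list \<Rightarrow> bool" where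
  "is_cycle f xs \<longleftrightarrow> xs \<noteq> [] \<and> distinct xs \<and>
     (\<forall>i<length xs. f (xs ! i) = xs ! (Suc i mod length xs))"

lemma sloane_rec:
  assumes "b \<ge> 2" "n > 0"
  shows "sloane t b n = (n mod b + t) * sloane t b (n div b)"
proof -
  have "floorlog b n = Suc (floorlog b (n div b))"
    using assms by (subst compute_floorlog) simp
  then show ?thesis
    by (simp only: sloane_def prod.lessThan_Suc_shift) (simp add: div_mult2_eq)
qed

lemma sloane_expansion:
  assumes "b \<ge> 2" "\<And>i. i \<le> k \<Longrightarrow> d i < b" "d k > 0"
    and "n = (\<Sum>i\<le>k. d i * b ^ i)"
  shows "sloane t b n = (\<Prod>i\<le>k. d i + t)"
  using assms(2-)
proof (induction k arbitrary: n d)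
  case 0
  then show ?case
    using assms(1) by (simp add: sloane_rec) (simp add: sloane_def floorlog_def)
next
  case (Suc k)
  define m where "m = (\<Sum>i\<le>k. d (Suc i) * b ^ i)"
  have n: "n = d 0 + b * m"
    unfolding Suc.prems(3) m_def
    by (subst sum.atMost_Suc_shift) (simp add: sum_distrib_left ac_simps)
  have d0: "d 0 < b" using Suc.prems(1) by simp
  have "m > 0" unfolding m_def
    using Suc.prems(2) assms(1) by (intro sum_pos2[of _ k]) auto
  then have "n > 0" using n assms(1) by simp
  moreover have "n mod b = d 0" "n div b = m"
    using n d0 by simp_all
  moreover have "sloane t b m = (\<Prod>i\<le>k. d (Suc i) + t)"
    by (rule Suc.IH) (use Suc.prems m_def in auto)
  ultimately show ?case
    using assms(1) by (simp only: sloane_rec prod.atMost_Suc_shift)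
qed

end

theory Submission
  imports Defs
begin

text \<open>
  Write \<open>n = b m + r\<close> with \<open>m > 0\<close>, so that \<open>f n = (r + 1) f m\<close>. Inductively \<open>f n \<le> n + 1\<close>, and
  equality forces every digit below the leading one to be \<open>b - 1\<close>. Then \<open>n + 1\<close> is a single digit
  followed by zeros (or a power of \<open>b\<close>), so \<open>f (n + 1) \<le> b < n\<close>. Equality \<open>f n = n\<close> leads to
  \<open>m (b - r - 1) = 1\<close>, that is \<open>n = 2 b - 2\<close>. Hence each \<open>n \<ge> b\<close> other than \<open>2 b - 2\<close> is mapped
  below itself by \<open>f\<close> or by \<open>f \<circ> f\<close>.
\<close>

lemma sloane_0 [simp]: "sloane t b 0 = 1"
  by (simp add: sloane_def floorlog_def)

lemma sloane_digit:
  assumes "b \<ge> 2" "0 < n" "n < b"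
  shows "sloane t b n = n + t"
  using assms by (simp add: sloane_rec)

lemma sloane_base:
  assumes "b \<ge> 2"
  shows "sloane t b b = t * (1 + t)"
  using assms by (simp add: sloane_rec[of b b] sloane_digit)

lemma sloane_pos:
  assumes "b \<ge> 2" "t > 0"
  shows "sloane t b n > 0"
  using assms by (auto simp: sloane_def intro!: prod_pos)

text \<open>Peeling off the last digit \<open>r\<close> gives \<open>(r + 1) * (m + 1) = (r + 1) * m
  + (r + 1) \<le> b * m + r + 1\<close>, because \<open>r + 1 \<le> b\<close>. The induction can
  start at 0 since the empty product is 1.\<close>

lemma sloane_1_le_Suc:
  assumes "b \<ge> 2"
  shows "sloane 1 b n \<le> Suc n"
proof (induction n rule: less_induct)
  case (less n)
  show ?case
  proof (cases "n = 0")
    case False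
    let ?m = "n div b" and ?r = "n mod b"
    have r: "Suc ?r \<le> b" using assms by (simp add: Suc_le_eq)
    have "sloane 1 b n = Suc ?r * sloane 1 b ?m"
      using assms False by (simp add: sloane_rec)
    also have "\<dots> \<le> Suc ?r * Suc ?m"
      using less.IH[of ?m] assms False by (intro mult_le_mono2) simp
    also have "\<dots> = Suc ?r * ?m + Suc ?r" by simp
    also have "\<dots> \<le> b * ?m + Suc ?r"
      using r by (intro add_right_mono mult_le_mono1)
    also have "\<dots> = Suc n" by simp
    finally show ?thesis .
  qed simp
qed

text \<open>Equality makes both estimates behind \<open>sloane_1_le_Suc\<close> tight; as
  \<open>m > 0\<close>, tightness of \<open>(r + 1) * m \<le> b * m\<close> means
  \<open>r + 1 = b\<close>.\<close>

lemma sloane_1_eq_SucD: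
  assumes "b \<ge> 2" "b \<le> n" "sloane 1 b n = Suc n"
  shows "n mod b = b - 1" "sloane 1 b (n div b) = Suc (n div b)"
proof -
  let ?m = "n div b" and ?r = "n mod b"
  have m: "?m > 0" using assms by (simp add: div_greater_zero_iff)
  have r: "Suc ?r \<le> b" using assms by (simp add: Suc_le_eq)
  have "Suc ?r * sloane 1 b ?m = Suc n"
    using assms sloane_rec[of b n 1] by simp
  also have "\<dots> = b * ?m + Suc ?r" by simp
  finally have eq: "Suc ?r * sloane 1 b ?m = b * ?m + Suc ?r" .
  show *: "sloane 1 b ?m = Suc ?m"
  proof (rule ccontr)
    assume "sloane 1 b ?m \<noteq> Suc ?m"
    then have "sloane 1 b ?m \<le> ?m" using sloane_1_le_Suc[OF assms(1), of ?m] by simp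
    then have "Suc ?r * sloane 1 b ?m \<le> b * ?m" using r by (rule mult_le_mono[rotated])
    then show False using eq by linarith
  qed
  have "Suc ?r * ?m = b * ?m" using eq unfolding * mult_Suc_right by linarith
  then have "Suc ?r = b" using m by (metis mult_cancel2 not_less0)
  then show "?r = b - 1" by linarith
qed

lemma sloane_1_fixpoint:
  assumes "b \<ge> 2" "b \<le> n" "sloane 1 b n = n"
  shows "n = 2 * b - 2"
proof -
  let ?m = "n div b" and ?r = "n mod b"
  have m: "?m > 0" using assms by (simp add: div_greater_zero_iff)
  have r: "Suc ?r \<le> b" using assms by (simp add: Suc_le_eq)
  have "Suc ?r * sloane 1 b ?m = n"
    using assms sloane_rec[of b n 1] by simp
  also have "\<dots> = b * ?m + ?r" by simp
  finally have eq: "Suc ?r * sloane 1 b ?m = b * ?m + ?r" .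
  \<comment> \<open>\<open>c\<close> is the gap \<open>b - r - 1\<close> between the last digit and
    the largest digit.\<close>
  obtain c where c: "b = Suc ?r + c" using r le_Suc_ex by blast
  have *: "sloane 1 b ?m = Suc ?m"
  proof (rule ccontr)
    assume "sloane 1 b ?m \<noteq> Suc ?m"
    then have "sloane 1 b ?m \<le> ?m" using sloane_1_le_Suc[OF assms(1), of ?m] by simp
    then have "Suc ?r * sloane 1 b ?m \<le> Suc ?r * ?m" by (rule mult_le_mono2)
    moreover have "b * ?m = Suc ?r * ?m + c * ?m"
      by (subst c) (rule add_mult_distrib)
    \<comment> \<open>\<open>eq\<close> now reads
      \<open>(r + 1) * f m = (r + 1) * m + c * m + r\<close>, so \<open>f m \<le> m\<close> kills
      the last two terms. With \<open>m > 0\<close> this leaves \<open>c = r = 0\<close>, that is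
      \<open>b = 1\<close>.\<close>
    ultimately have "?r = 0" "c * ?m = 0" using eq by linarith+
    then show False using c m assms(1) by simp
  qed
  have "b * ?m = Suc ?r * ?m + c * ?m"
    by (subst c) (rule add_mult_distrib)
  then have "c * ?m = 1" using eq unfolding * by simp
  then have "c = 1" "?m = 1" by simp_all
  then show ?thesis
    using c div_mult_mod_eq[of n b] by simp
qed

text \<open>A last digit \<open>b - 1\<close> carries: \<open>n + 1 = b * (m + 1)\<close>, and its
  final 0 contributes the factor 1, so \<open>f (n + 1) = f (m + 1)\<close>. This descends to a
  single digit \<open>n\<close>, where the value is \<open>n + 2 \<le> b\<close>, or
  \<open>f b = 2\<close> if \<open>n + 1 = b\<close>.\<close>

lemma sloane_1_Suc_le_base:
  assumes "b \<ge> 2" "n > 0" "sloane 1 b n = Suc n"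
  shows "sloane 1 b (Suc n) \<le> b"
  using assms(2,3)
proof (induction n rule: less_induct)
  case (less n)
  consider "Suc n < b" | "Suc n = b" | "b \<le> n" by linarith
  then show ?case
  proof cases
    case 1
    then show ?thesis using assms by (simp add: sloane_digit)
  next
    case 2
    then show ?thesis using assms by (simp add: sloane_base)
  next
    case 3
    let ?m = "n div b"
    note D = sloane_1_eq_SucD[OF assms(1) 3 less.prems(2)]
    have "n = b * ?m + (b - 1)" using D(1) mult_div_mod_eq[of b n] by simp
    then have "Suc n = b * Suc ?m" using assms(1) by simp
    then have "Suc n mod b = 0" "Suc n div b = Suc ?m" using assms(1) by simp_all
    then have "sloane 1 b (Suc n) = sloane 1 b (Suc ?m)"
      using assms(1) by (simp add: sloane_rec[of b "Suc n"])
    also have "\<dots> \<le> b"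
      using less.IH[of ?m] D(2) 3 assms(1) by (simp add: div_greater_zero_iff)
    finally show ?thesis .
  qed
qed

lemma sloane_1_descent:
  assumes "b \<ge> 2" "b \<le> n" "n \<noteq> 2 * b - 2"
  shows "\<exists>k. (sloane 1 b ^^ k) n < n"
proof -
  consider "sloane 1 b n < n" | "sloane 1 b n = Suc n"
    using sloane_1_le_Suc[OF assms(1), of n] sloane_1_fixpoint[OF assms(1,2)] assms(3)
    by linarith
  then show ?thesis
  proof cases
    case 1
    then have "(sloane 1 b ^^ 1) n < n" by simp
    then show ?thesis by blast
  next
    case 2
    \<comment> \<open>Since \<open>f b = 2\<close>, the case \<open>n = b\<close> drops out, which
      makes the bound \<open>f (f n) \<le> b < n\<close> strict.\<close>
    have "n \<noteq> b" using 2 assms(1) by (auto simp: sloane_base)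
    then have "sloane 1 b (Suc n) < n"
      using sloane_1_Suc_le_base[OF assms(1) _ 2] assms by linarith
    then have "(sloane 1 b ^^ 2) n < n" using 2 by (simp add: numeral_2_eq_2)
    then show ?thesis by blast
  qed
qed

lemma sloane_1_reaches_cycle:
  assumes "b \<ge> 2" "n > 0"
  shows "\<exists>k. (sloane 1 b ^^ k) n \<in> {2..b} \<or> (sloane 1 b ^^ k) n = 2 * b - 2"
  using assms(2)
proof (induction n rule: less_induct)
  case (less n)
  consider "n = 1" | "n \<in> {2..b} \<or> n = 2 * b - 2" | "b < n" "n \<noteq> 2 * b - 2"
    using less.prems by fastforce
  then show ?case
  proof cases
    case 1
    then have "(sloane 1 b ^^ 1) n \<in> {2..b}" using assms(1) by (simp add: sloane_digit)
    then show ?thesis by blast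
  next
    case 2
    then have "(sloane 1 b ^^ 0) n \<in> {2..b} \<or> (sloane 1 b ^^ 0) n = 2 * b - 2" by simp
    then show ?thesis by blast
  next
    case 3
    obtain k where k: "(sloane 1 b ^^ k) n < n"
      using sloane_1_descent[OF assms(1) _ 3(2)] 3(1) by auto
    \<comment> \<open>The induction hypothesis covers positive numbers only.\<close>
    have "(sloane 1 b ^^ k) n > 0"
      using less.prems sloane_pos[OF assms(1)] by (cases k) simp_all
    from less.IH[OF k this] show ?thesis
      by (metis funpow_add comp_apply)
  qed
qed

lemma is_cycle_singleton [simp]: "is_cycle f [x] \<longleftrightarrow> f x = x"
  by (simp add: is_cycle_def)

lemma sloane_1_is_cycle:
  assumes "b \<ge> 3"
  shows "is_cycle (sloane 1 b) ([2..<b] @ [b])"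
proof -
  have upt: "[2..<b] @ [b] = [2..<Suc b]" using assms by simp
  show ?thesis
    unfolding upt is_cycle_def
  proof (intro conjI allI impI)
    fix i assume "i < length [2..<Suc b]"
    then have "i < Suc b - 2" by (simp only: length_upt)
    then consider "i + 2 < b" | "i = b - 2" by linarith
    then show "sloane 1 b ([2..<Suc b] ! i) = [2..<Suc b] ! (Suc i mod length [2..<Suc b])"
    proof cases
      case 1
      then show ?thesis by (simp add: sloane_digit nth_upt del: upt_Suc)
    next
      \<comment> \<open>Index \<open>b - 2\<close> holds the last entry \<open>b\<close>, which
        wraps around to the head 2.\<close>
      case 2
      then have "Suc i = length [2..<Suc b]" using assms by simp
      then show ?thesis
        using 2 assms by (simp add: sloane_base nth_upt del: upt_Suc)
    qed
  qed (use assms in simp_all)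
qed

lemma sloane_1_twice_base_minus_2:
  assumes "b \<ge> 2"
  shows "sloane 1 b (2 * b - 2) = 2 * b - 2"
proof -
  \<comment> \<open>The digits are 1 and \<open>b - 2\<close>, with shifted product
    \<open>2 * (b - 1)\<close>.\<close>
  have n: "2 * b - 2 = b * 1 + (b - 2)" using assms by simp
  have "(2 * b - 2) div b = 1" "(2 * b - 2) mod b = b - 2"
    unfolding n using assms by (simp_all only: div_mult_self4 mod_mult_self4) simp_all
  then show ?thesis
    using assms by (simp add: sloane_rec[of b "2 * b - 2"] sloane_digit)
qed

theorem theorem7:
  fixes b :: nat and f :: "nat \<Rightarrow> nat"
  assumes "b \<ge> 2" and "f = sloane 1 b"
  shows "(b = 2 \<longrightarrow>
            base_num 2 [1, 0] = 2 \<and>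
            is_cycle f [base_num 2 [1, 0]] \<and>
            (\<forall>n>0. \<exists>k. (f ^^ k) n = base_num 2 [1, 0])) \<and>
         (b \<ge> 3 \<longrightarrow>
            base_num b [1, 0] = b \<and>
            base_num b [1, b - 2] = 2 * b - 2 \<and>
            is_cycle f ([2..<b] @ [base_num b [1, 0]]) \<and>
            (\<forall>j\<in>{2..b - 1}. f j = j + 1) \<and> f b = 2 \<and>
            is_cycle f [base_num b [1, b - 2]] \<and>
            (\<forall>n>0. \<exists>k. (f ^^ k) n \<in> set ([2..<b] @ [base_num b [1, 0]]) \<or>
                        (f ^^ k) n = base_num b [1, b - 2]))"
proof (intro conjI impI)
  have reaches: "\<exists>k. (f ^^ k) n \<in> {2..b} \<or> (f ^^ k) n = 2 * b - 2" if "n > 0" for n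
    using sloane_1_reaches_cycle[OF assms(1) that] assms(2) by simp
  have num: "base_num b [1, 0] = b" "base_num b [1, b - 2] = 2 * b - 2"
    using assms(1) by (simp_all add: base_num_def)
  {
    \<comment> \<open>Here \<open>{2..b}\<close> and \<open>2 * b - 2\<close> both collapse to
      2.\<close>
    assume "b = 2"
    then show "base_num 2 [1, 0] = 2" "is_cycle f [base_num 2 [1, 0]]"
      "\<forall>n>0. \<exists>k. (f ^^ k) n = base_num 2 [1, 0]"
      using num(1) reaches sloane_base[of 2 1] assms(2) by auto
  next
    assume b: "b \<ge> 3"
    show "base_num b [1, 0] = b" "base_num b [1, b - 2] = 2 * b - 2" by (fact num)+
    show "is_cycle f ([2..<b] @ [base_num b [1, 0]])"
      using sloane_1_is_cycle[OF b] num assms(2) by simp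
    show "\<forall>j\<in>{2..b - 1}. f j = j + 1"
      using assms by (auto simp: sloane_digit)
    show "f b = 2" using assms by (simp add: sloane_base)
    show "is_cycle f [base_num b [1, b - 2]]"
      using sloane_1_twice_base_minus_2[OF assms(1)] num assms(2) by simp
    have "set ([2..<b] @ [b]) = {2..b}" using b by auto
    then show "\<forall>n>0. \<exists>k. (f ^^ k) n \<in> set ([2..<b] @ [base_num b [1, 0]]) \<or>
                    (f ^^ k) n = base_num b [1, b - 2]"
      unfolding num using reaches by simp
  }
qed

end
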